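(* Let $\nu:\mathbb{N}^+\to(0,\infty)$. Suppose that for each $n\in\mathbb{N}^+$ and each convex body $K\subseteq\mathbb{R}^n$ we have a function $\phi_{n,K}:\operatorname{int}K\to\mathbb{R}$ such that $\phi_{n,K}$ is a $\nu(n)$-self-concordant barrier for $K$. Suppose also that the following consistency condition holds: $$\phi_{m+n,\,K\times K'}(x,x')=\phi_{m,K}(x)+\phi_{n,K'}(x')$$ for all $m,n\in\mathbb{N}^+$, all convex bodies $K\subseteq\mathbb{R}^m$ and $K'\subseteq\mathbb{R}^n$, and all $x\in\operatorname{int}K$, $x'\in\operatorname{int}K'$. Then for every $n\in\mathbb{N}^+$ and every convex body $K\subseteq\mathbb{R}^n$, the function $\phi_{n,K}$ is a $\bigl(\inf_{k\in\mathbb{N}^+}\nu(kn)/k\bigr)$-self-concordant barrier for $K$.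
   Context: $\mathbb{N}^+=\{1,2,3,\dots\}$. A convex body $K\subseteq\mathbb{R}^n$ is a compact convex set with nonempty interior $\operatorname{int}K$. For convex bodies $K\subseteq\mathbb{R}^m$ and $K'\subseteq\mathbb{R}^n$, the product $K\times K'$ is regarded as a convex body in $\mathbb{R}^{m}\times\mathbb{R}^n=\mathbb{R}^{m+n}$. For $\nu>0$, a twice differentiable function $\phi:\operatorname{int}K\to\mathbb{R}$ is called a $\nu$-self-concordant barrier for $K$ if $$\nabla^2\phi(x)\succeq\frac1\nu\,\nabla\phi(x)\,\nabla\phi(x)^{\mathsf T}\qquad\text{for all }x\in\operatorname{int}K,$$ equivalently $\nu\,\nabla^2\phi(x)\succeq\nabla\phi(x)\nabla\phi(x)^{\mathsf T}$ for all $x\in\operatorname{int}K$; the latter form is used as the definition in the degenerate case $\nu=0$. Here $\nabla$ and $\nabla^2$ denote the gradient and Hessian, and $A\succeq B$ means that $A-B$ is positive semidefinite. *)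

theory Defs
  imports "HOL-Analysis.Analysis"
begin

text \<open>
  The dimension varies inside the statement, so \<open>\<real>\<^sup>n\<close> is the library's
  \<^const>\<open>Euclidean_space\<close> \<open>n\<close>: functions \<open>nat \<Rightarrow> real\<close> that vanish at all indices
  \<open>\<ge> n\<close>, with the Euclidean topology; the coordinates are the indices \<open>0, \<dots>, n - 1\<close>.
  The function type is not an instance of the class of real vector spaces,
  so convexity is written out.
\<close>

definition convex_body :: "nat \<Rightarrow> (nat \<Rightarrow> real) set \<Rightarrow> bool" where
  "convex_body n K \<longleftrightarrow>
     compactin (Euclidean_space n) K \<and>
     (\<forall>x\<in>K. \<forall>y\<in>K. \<forall>t\<in>{0..1}. (\<lambda>i. (1 - t) * x i + t * y i) \<in> K) \<and>
     Euclidean_space n interior_of K \<noteq> {}"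

text \<open>
  The identification of \<open>\<real>\<^sup>m \<times> \<real>\<^sup>n\<close> with \<open>\<real>\<^sup>m\<^sup>+\<^sup>n\<close>: the coordinates of \<open>x\<close> come first,
  followed by those of \<open>x'\<close>.
\<close>

definition pair_vec :: "nat \<Rightarrow> (nat \<Rightarrow> real) \<Rightarrow> (nat \<Rightarrow> real) \<Rightarrow> (nat \<Rightarrow> real)" where
  "pair_vec m x x' = (\<lambda>i. if i < m then x i else x' (i - m))"

definition prod_body :: "nat \<Rightarrow> (nat \<Rightarrow> real) set \<Rightarrow> (nat \<Rightarrow> real) set \<Rightarrow> (nat \<Rightarrow> real) set" where
  "prod_body m K K' = {pair_vec m x x' | x x'. x \<in> K \<and> x' \<in> K'}"

text \<open>
  Frechet differentiability. The filter \<open>atin (Euclidean_space n) x\<close> consists of the punctured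
  neighbourhoods of \<open>x\<close> in \<open>\<real>\<^sup>n\<close>, so at an interior point of a body only the values of \<open>f\<close> on
  the interior matter.
\<close>

definition differentiable_pt :: "nat \<Rightarrow> ((nat \<Rightarrow> real) \<Rightarrow> real) \<Rightarrow> (nat \<Rightarrow> real) \<Rightarrow> bool" where
  "differentiable_pt n f x \<longleftrightarrow>
     (\<exists>a. ((\<lambda>y. (f y - f x - (\<Sum>i<n. a i * (y i - x i))) / L2_set (\<lambda>i. y i - x i) {..<n})
           \<longlongrightarrow> 0) (atin (Euclidean_space n) x))"

definition partial_deriv :: "nat \<Rightarrow> ((nat \<Rightarrow> real) \<Rightarrow> real) \<Rightarrow> (nat \<Rightarrow> real) \<Rightarrow> real" where
  "partial_deriv i f x = deriv (\<lambda>t. f (x(i := t))) (x i)"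

definition gradient :: "((nat \<Rightarrow> real) \<Rightarrow> real) \<Rightarrow> (nat \<Rightarrow> real) \<Rightarrow> nat \<Rightarrow> real" where
  "gradient f x = (\<lambda>i. partial_deriv i f x)"

definition hessian :: "((nat \<Rightarrow> real) \<Rightarrow> real) \<Rightarrow> (nat \<Rightarrow> real) \<Rightarrow> nat \<Rightarrow> nat \<Rightarrow> real" where
  "hessian f x = (\<lambda>i j. partial_deriv i (partial_deriv j f) x)"

text \<open>
  Only the entries with indices below \<open>n\<close> of \<^const>\<open>gradient\<close> and \<^const>\<open>hessian\<close> are meaningful
  in \<open>\<real>\<^sup>n\<close>, and only those are used below.
\<close>

definition twice_differentiable_in ::
    "nat \<Rightarrow> ((nat \<Rightarrow> real) \<Rightarrow> real) \<Rightarrow> (nat \<Rightarrow> real) set \<Rightarrow> bool" where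
  "twice_differentiable_in n f U \<longleftrightarrow>
     (\<forall>x\<in>U. differentiable_pt n f x \<and> (\<forall>i<n. differentiable_pt n (\<lambda>y. gradient f y i) x))"

definition pos_semidef :: "nat \<Rightarrow> (nat \<Rightarrow> nat \<Rightarrow> real) \<Rightarrow> bool" where
  "pos_semidef n A \<longleftrightarrow>
     (\<forall>i<n. \<forall>j<n. A i j = A j i) \<and>
     (\<forall>v :: nat \<Rightarrow> real. 0 \<le> (\<Sum>i<n. \<Sum>j<n. v i * A i j * v j))"

definition loewner_ge :: "nat \<Rightarrow> (nat \<Rightarrow> nat \<Rightarrow> real) \<Rightarrow> (nat \<Rightarrow> nat \<Rightarrow> real) \<Rightarrow> bool" where
  "loewner_ge n A B \<longleftrightarrow> pos_semidef n (\<lambda>i j. A i j - B i j)"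

definition outer :: "(nat \<Rightarrow> real) \<Rightarrow> nat \<Rightarrow> nat \<Rightarrow> real" where
  "outer g = (\<lambda>i j. g i * g j)"

text \<open>
  The second disjunct covers the degenerate parameter \<open>\<nu> = 0\<close>, where dividing by \<open>\<nu>\<close>
  makes no sense.
\<close>

definition self_concordant_barrier ::
    "real \<Rightarrow> nat \<Rightarrow> (nat \<Rightarrow> real) set \<Rightarrow> ((nat \<Rightarrow> real) \<Rightarrow> real) \<Rightarrow> bool" where
  "self_concordant_barrier \<nu> n K f \<longleftrightarrow>
     twice_differentiable_in n f (Euclidean_space n interior_of K) \<and>
     (\<forall>x \<in> Euclidean_space n interior_of K.
        (\<nu> > 0 \<and> loewner_ge n (hessian f x) (\<lambda>i j. (1 / \<nu>) * outer (gradient f x) i j)) \<or>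
        (\<nu> = 0 \<and> loewner_ge n (\<lambda>i j. \<nu> * hessian f x i j) (outer (gradient f x))))"

end

theory Submission
  imports Defs
begin

text \<open>
  The barrier inequality in dimension \<open>k * n\<close>, tested on the diagonal of a power, improves with
  \<open>k\<close>. By consistency the function on \<open>K\<^sup>k\<close> is the separable sum \<open>\<phi>(x\<^sub>1) + \<dots> + \<phi>(x\<^sub>k)\<close>, where
  \<open>\<phi> = \<phi>\<^sub>n\<^sub>,\<^sub>K\<close>, so at \<open>(x, \<dots>, x)\<close> its Hessian is block diagonal with \<open>k\<close> copies of \<open>\<nabla>\<^sup>2\<phi>(x)\<close>, and its
  gradient consists of \<open>k\<close> copies of \<open>\<nabla>\<phi>(x)\<close>. In the direction \<open>(v, \<dots>, v)\<close> the quadratic form of the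
  Hessian is therefore \<open>k\<close> times that of \<open>\<phi>\<close>, while the square of the directional derivative gains
  a factor \<open>k\<^sup>2\<close>. The inequality for the parameter \<open>\<nu> (k * n)\<close> becomes
  \<open>(\<nabla>\<phi>(x) \<bullet> v)\<^sup>2 \<le> (\<nu> (k * n) / k) * (v \<bullet> \<nabla>\<^sup>2\<phi>(x) v)\<close>,
  and the infimum over \<open>k\<close> may be taken on the right because the quadratic form is nonnegative.
  Smoothness and symmetry of the Hessian do not depend on the parameter and come from \<open>k = 1\<close>.

  The substance lies in two facts about a product: its interior is the product of the interiors
  (\<open>prod_body_interior\<close>, from a homeomorphism), and both the directional derivative and the
  Hessian form of a separable sum split (\<open>separable_sum_forms\<close>). They are iterated in
  \<open>diagonal_power\<close>.
\<close>

section \<open>Products of convex bodies\<close>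

lemma homeomorphic_map_pair_vec:
  "homeomorphic_map (prod_topology (Euclidean_space m) (Euclidean_space n))
     (Euclidean_space (m + n)) (\<lambda>(x, x'). pair_vec m x x')"
proof -
  let ?P = "prod_topology (Euclidean_space m) (Euclidean_space n)"
  let ?f = "\<lambda>(x, x'). pair_vec m x x'"
  let ?g = "\<lambda>z. (\<lambda>i. if i < m then z i else 0, \<lambda>i. if i < n then z (m + i) else 0)"
  have proj: "continuous_map (Euclidean_space l) euclideanreal (\<lambda>x. x i)" for l i
    unfolding Euclidean_space_def
    by (intro continuous_map_from_subtopology continuous_map_product_projection) simp
  have left: "continuous_map ?P euclideanreal (\<lambda>z. fst z i)" for i
    using continuous_map_compose[OF continuous_map_fst proj] by (simp add: o_def)
  have right: "continuous_map ?P euclideanreal (\<lambda>z. snd z i)" for i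
    using continuous_map_compose[OF continuous_map_snd proj] by (simp add: o_def)
  have "continuous_map ?P (Euclidean_space (m + n))
          (\<lambda>z i. if i < m + n then (if i < m then fst z i else snd z (i - m)) else 0)"
    unfolding continuous_map_componentwise_Euclidean_space using left right by auto
  then have "continuous_map ?P (Euclidean_space (m + n)) ?f"
    by (rule continuous_map_eq) (auto simp: pair_vec_def topspace_Euclidean_space fun_eq_iff)
  moreover have "continuous_map (Euclidean_space (m + n)) ?P ?g"
    by (simp add: continuous_map_pairedI continuous_map_componentwise_Euclidean_space proj)
  moreover have "\<forall>x \<in> topspace ?P. ?g (?f x) = x"
    by (auto simp: pair_vec_def topspace_Euclidean_space fun_eq_iff)
  moreover have "\<forall>z \<in> topspace (Euclidean_space (m + n)). ?f (?g z) = z"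
    by (auto simp: pair_vec_def topspace_Euclidean_space fun_eq_iff)
  ultimately show ?thesis
    unfolding homeomorphic_map_maps homeomorphic_maps_def by blast
qed

lemma prod_body_image: "prod_body m K K' = (\<lambda>(x, x'). pair_vec m x x') ` (K \<times> K')"
  by (auto simp: prod_body_def)

lemma prod_body_interior:
  assumes "K \<subseteq> topspace (Euclidean_space m)" and "K' \<subseteq> topspace (Euclidean_space n)"
  shows "Euclidean_space (m + n) interior_of prod_body m K K' =
         prod_body m (Euclidean_space m interior_of K) (Euclidean_space n interior_of K')"
proof -
  have "K \<times> K' \<subseteq> topspace (prod_topology (Euclidean_space m) (Euclidean_space n))"
    using assms by auto
  from homeomorphic_map_interior_of[OF homeomorphic_map_pair_vec this] show ?thesis
    by (simp add: prod_body_image interior_of_Times)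
qed

lemma convex_body_subset_topspace: "convex_body n K \<Longrightarrow> K \<subseteq> topspace (Euclidean_space n)"
  by (simp add: convex_body_def compactin_subset_topspace)

lemma pair_vec_in_interior:
  assumes "convex_body m K" and "convex_body n K'"
    and "x \<in> Euclidean_space m interior_of K" and "x' \<in> Euclidean_space n interior_of K'"
  shows "pair_vec m x x' \<in> Euclidean_space (m + n) interior_of prod_body m K K'"
  using assms prod_body_interior[of K m K' n]
  by (auto simp: convex_body_subset_topspace prod_body_image)

lemma convex_body_prod_body:
  assumes K: "convex_body m K" and K': "convex_body n K'"
  shows "convex_body (m + n) (prod_body m K K')"
  unfolding convex_body_def
proof (intro conjI ballI)
  have "compactin (prod_topology (Euclidean_space m) (Euclidean_space n)) (K \<times> K')"
    using K K' by (simp add: compactin_Times convex_body_def)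
  then show "compactin (Euclidean_space (m + n)) (prod_body m K K')"
    unfolding prod_body_image
    by (rule image_compactin) (simp add: homeomorphic_imp_continuous_map homeomorphic_map_pair_vec)
next
  fix y z and t :: real
  assume "y \<in> prod_body m K K'" and "z \<in> prod_body m K K'" and t: "t \<in> {0..1}"
  then obtain y1 y2 z1 z2 where y: "y = pair_vec m y1 y2" "y1 \<in> K" "y2 \<in> K'"
    and z: "z = pair_vec m z1 z2" "z1 \<in> K" "z2 \<in> K'"
    by (auto simp: prod_body_def)
  have "(\<lambda>i. (1 - t) * y i + t * z i) =
        pair_vec m (\<lambda>i. (1 - t) * y1 i + t * z1 i) (\<lambda>i. (1 - t) * y2 i + t * z2 i)"
    by (auto simp: y z pair_vec_def)
  moreover have "(\<lambda>i. (1 - t) * y1 i + t * z1 i) \<in> K" "(\<lambda>i. (1 - t) * y2 i + t * z2 i) \<in> K'"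
    using K K' y z t by (auto simp: convex_body_def)
  ultimately show "(\<lambda>i. (1 - t) * y i + t * z i) \<in> prod_body m K K'"
    unfolding prod_body_def by blast
next
  show "Euclidean_space (m + n) interior_of prod_body m K K' \<noteq> {}"
    using K K' pair_vec_in_interior[OF K K'] unfolding convex_body_def by blast
qed

section \<open>Derivatives of separable sums\<close>

text \<open>
  Moving along a coordinate line is continuous into \<open>\<real>\<^sup>n\<close>, so a partial derivative at a point of an
  open set only sees values of the function on that set.
\<close>

lemma eventually_fun_upd_in_open:
  assumes U: "openin (Euclidean_space n) U" and "y \<in> U" and "i < n"
  shows "\<forall>\<^sub>F t in nhds (y i). y(i := t) \<in> U"
proof -
  have y: "y \<in> topspace (Euclidean_space n)"
    using U \<open>y \<in> U\<close> openin_subset by blast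
  have "continuous_map euclideanreal (Euclidean_space n)
          (\<lambda>t j. if j < n then (if j = i then t else y j) else 0)"
    unfolding continuous_map_componentwise_Euclidean_space by auto
  then have "continuous_map euclideanreal (Euclidean_space n) (\<lambda>t. y(i := t))"
    by (rule continuous_map_eq)
       (use y \<open>i < n\<close> in \<open>auto simp: topspace_Euclidean_space fun_eq_iff\<close>)
  then have "openin euclideanreal {t \<in> topspace euclideanreal. y(i := t) \<in> U}"
    using U openin_continuous_map_preimage by blast
  then show ?thesis
    using \<open>y \<in> U\<close> by (auto simp: eventually_nhds)
qed

text \<open>
  Since \<^const>\<open>deriv\<close> chooses among the possible derivatives, a shift by a constant leaves it
  unchanged even where the function has no derivative.
\<close>

lemma deriv_add_const:
  fixes f :: "real \<Rightarrow> real"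
  shows "deriv (\<lambda>t. f t + c) x = deriv f x"
proof -
  have "((\<lambda>t. f t + c) has_field_derivative D) (at x) = (f has_field_derivative D) (at x)" for D
    using DERIV_add[OF _ DERIV_const[of c], of f D x UNIV]
      DERIV_add[OF _ DERIV_const[of "- c"], of "\<lambda>t. f t + c" D x UNIV] by auto
  then show ?thesis
    by (simp add: deriv_def)
qed

text \<open>
  In both lemmas below, the block that stays fixed contributes only the constant \<open>c\<close>. Here \<open>F\<close> may
  itself be a partial derivative: that is how they yield the entries of the Hessian, those in the
  off-diagonal blocks with \<open>f = 0\<close> or \<open>g = 0\<close>.
\<close>

lemma partial_deriv_pair_left:
  assumes U: "openin (Euclidean_space m) U" and y: "y \<in> U" and i: "i < m"
    and F: "\<And>z. z \<in> U \<Longrightarrow> F (pair_vec m z y') = f z + c"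
  shows "partial_deriv i F (pair_vec m y y') = partial_deriv i f y"
proof -
  have upd: "(pair_vec m y y')(i := t) = pair_vec m (y(i := t)) y'" for t
    using i by (auto simp: pair_vec_def)
  have "\<forall>\<^sub>F t in nhds (y i). F ((pair_vec m y y')(i := t)) = f (y(i := t)) + c"
    using eventually_fun_upd_in_open[OF U y i] by eventually_elim (simp add: upd F)
  then have "partial_deriv i F (pair_vec m y y') = deriv (\<lambda>t. f (y(i := t)) + c) (y i)"
    unfolding partial_deriv_def using i by (intro deriv_cong_ev) (auto simp: pair_vec_def)
  then show ?thesis
    by (simp add: deriv_add_const partial_deriv_def)
qed

lemma partial_deriv_pair_right:
  assumes W: "openin (Euclidean_space n) W" and y': "y' \<in> W" and i: "i < n"
    and F: "\<And>z. z \<in> W \<Longrightarrow> F (pair_vec m y z) = g z + c"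
  shows "partial_deriv (m + i) F (pair_vec m y y') = partial_deriv i g y'"
proof -
  have upd: "(pair_vec m y y')(m + i := t) = pair_vec m y (y'(i := t))" for t
    by (auto simp: pair_vec_def fun_eq_iff)
  have "\<forall>\<^sub>F t in nhds (y' i). F ((pair_vec m y y')(m + i := t)) = g (y'(i := t)) + c"
    using eventually_fun_upd_in_open[OF W y' i] by eventually_elim (simp add: upd F)
  then have "partial_deriv (m + i) F (pair_vec m y y') = deriv (\<lambda>t. g (y'(i := t)) + c) (y' i)"
    unfolding partial_deriv_def by (intro deriv_cong_ev) (auto simp: pair_vec_def)
  then show ?thesis
    by (simp add: deriv_add_const partial_deriv_def)
qed

lemma partial_deriv_zero: "partial_deriv i (\<lambda>_. 0) x = 0"
  by (simp add: partial_deriv_def)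

definition dir_deriv :: "nat \<Rightarrow> ((nat \<Rightarrow> real) \<Rightarrow> real) \<Rightarrow> (nat \<Rightarrow> real) \<Rightarrow> (nat \<Rightarrow> real) \<Rightarrow> real" where
  "dir_deriv n f x v = (\<Sum>i<n. gradient f x i * v i)"

definition hess_form :: "nat \<Rightarrow> ((nat \<Rightarrow> real) \<Rightarrow> real) \<Rightarrow> (nat \<Rightarrow> real) \<Rightarrow> (nat \<Rightarrow> real) \<Rightarrow> real" where
  "hess_form n f x v = (\<Sum>i<n. \<Sum>j<n. v i * hessian f x i j * v j)"

lemma sum_lessThan_add:
  fixes m n :: nat and f :: "nat \<Rightarrow> real"
  shows "(\<Sum>i<m + n. f i) = (\<Sum>i<m. f i) + (\<Sum>i<n. f (m + i))"
  by (induction n) (simp_all add: add.assoc)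

lemma separable_sum_forms:
  assumes U: "openin (Euclidean_space m) U" and W: "openin (Euclidean_space n) W"
    and F: "\<And>z z'. z \<in> U \<Longrightarrow> z' \<in> W \<Longrightarrow> F (pair_vec m z z') = f z + g z'"
    and x: "x \<in> U" and x': "x' \<in> W"
  shows "dir_deriv (m + n) F (pair_vec m x x') (pair_vec m v v') =
           dir_deriv m f x v + dir_deriv n g x' v'"
    and "hess_form (m + n) F (pair_vec m x x') (pair_vec m v v') =
           hess_form m f x v + hess_form n g x' v'"
proof -
  have L: "partial_deriv i F (pair_vec m z z') = partial_deriv i f z"
    if "z \<in> U" "z' \<in> W" "i < m" for z z' i
    using partial_deriv_pair_left[OF U that(1,3), of F z' f "g z'"] F that(2) by blast
  have R: "partial_deriv (m + i) F (pair_vec m z z') = partial_deriv i g z'"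
    if "z \<in> U" "z' \<in> W" "i < n" for z z' i
    using partial_deriv_pair_right[OF W that(2,3), of F m z g "f z"] F that(1)
    by (simp add: add.commute)
  have LL: "hessian F (pair_vec m x x') i j = hessian f x i j" if "i < m" "j < m" for i j
    unfolding hessian_def
    by (rule partial_deriv_pair_left[OF U x that(1), where c = 0]) (simp add: L x' that)
  have RR: "hessian F (pair_vec m x x') (m + i) (m + j) = hessian g x' i j"
    if "i < n" "j < n" for i j
    unfolding hessian_def
    by (rule partial_deriv_pair_right[OF W x' that(1), where c = 0]) (simp add: R x that)
  have LR: "hessian F (pair_vec m x x') i (m + j) = 0" if "i < m" "j < n" for i j
    unfolding hessian_def
    by (subst partial_deriv_pair_left[OF U x that(1), where f = "\<lambda>_. 0" and
          c = "partial_deriv j g x'"]) (simp_all add: R x' that partial_deriv_zero)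
  have RL: "hessian F (pair_vec m x x') (m + i) j = 0" if "i < n" "j < m" for i j
    unfolding hessian_def
    by (subst partial_deriv_pair_right[OF W x' that(1), where g = "\<lambda>_. 0" and
          c = "partial_deriv j f x"]) (simp_all add: L x that partial_deriv_zero)
  have v: "pair_vec m v v' i = v i" if "i < m" for i
    using that by (simp add: pair_vec_def)
  have v': "pair_vec m v v' (m + i) = v' i" for i
    by (simp add: pair_vec_def)
  show "dir_deriv (m + n) F (pair_vec m x x') (pair_vec m v v') =
          dir_deriv m f x v + dir_deriv n g x' v'"
    by (simp add: dir_deriv_def gradient_def sum_lessThan_add L R x x' v v')
  show "hess_form (m + n) F (pair_vec m x x') (pair_vec m v v') =
          hess_form m f x v + hess_form n g x' v'"
    by (simp add: hess_form_def sum_lessThan_add LL LR RL RR v v')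
qed

section \<open>The barrier inequality by directions\<close>

lemma quadratic_form_hessian_outer:
  "(\<Sum>i<n. \<Sum>j<n. v i * (a * hessian f x i j - b * outer (gradient f x) i j) * v j) =
     a * hess_form n f x v - b * (dir_deriv n f x v)\<^sup>2"
proof -
  have "(dir_deriv n f x v)\<^sup>2 = (\<Sum>i<n. \<Sum>j<n. v i * outer (gradient f x) i j * v j)"
    by (simp add: dir_deriv_def power2_eq_square sum_product outer_def mult_ac)
  then show ?thesis
    by (simp add: hess_form_def algebra_simps sum_subtractf sum_distrib_left)
qed

lemma self_concordant_barrierD:
  assumes "self_concordant_barrier \<nu> n K f" and "0 < \<nu>"
    and "x \<in> Euclidean_space n interior_of K"
  shows "\<And>i j. i < n \<Longrightarrow> j < n \<Longrightarrow> hessian f x i j = hessian f x j i"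
    and "(dir_deriv n f x v)\<^sup>2 \<le> \<nu> * hess_form n f x v"
proof -
  have psd: "pos_semidef n (\<lambda>i j. hessian f x i j - (1 / \<nu>) * outer (gradient f x) i j)"
    using assms by (auto simp: self_concordant_barrier_def loewner_ge_def)
  show "hessian f x i j = hessian f x j i" if "i < n" "j < n" for i j
  proof -
    have "hessian f x i j - (1 / \<nu>) * outer (gradient f x) i j =
          hessian f x j i - (1 / \<nu>) * outer (gradient f x) j i"
      using psd that unfolding pos_semidef_def by blast
    then show ?thesis
      by (simp add: outer_def mult.commute)
  qed
  have "0 \<le> hess_form n f x v - (1 / \<nu>) * (dir_deriv n f x v)\<^sup>2"
    using psd unfolding quadratic_form_hessian_outer[of v 1 f x "1 / \<nu>" n, simplified mult_1, symmetric]
      pos_semidef_def by blast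
  then show "(dir_deriv n f x v)\<^sup>2 \<le> \<nu> * hess_form n f x v"
    using \<open>0 < \<nu>\<close> by (simp add: field_simps)
qed

lemma self_concordant_barrierI:
  assumes "0 \<le> \<nu>" and "twice_differentiable_in n f (Euclidean_space n interior_of K)"
    and sym: "\<And>x i j. x \<in> Euclidean_space n interior_of K \<Longrightarrow> i < n \<Longrightarrow> j < n \<Longrightarrow>
               hessian f x i j = hessian f x j i"
    and ineq: "\<And>x v. x \<in> Euclidean_space n interior_of K \<Longrightarrow>
               (dir_deriv n f x v)\<^sup>2 \<le> \<nu> * hess_form n f x v"
  shows "self_concordant_barrier \<nu> n K f"
proof -
  have loewner: "loewner_ge n (\<lambda>i j. a * hessian f x i j) (\<lambda>i j. b * outer (gradient f x) i j)"
    if x: "x \<in> Euclidean_space n interior_of K"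
      and ab: "\<And>v. b * (dir_deriv n f x v)\<^sup>2 \<le> a * hess_form n f x v" for x a b
    unfolding loewner_ge_def pos_semidef_def quadratic_form_hessian_outer
    using ab sym[OF x] by (auto simp: outer_def)
  have "(\<nu> > 0 \<and> loewner_ge n (hessian f x) (\<lambda>i j. (1 / \<nu>) * outer (gradient f x) i j)) \<or>
        (\<nu> = 0 \<and> loewner_ge n (\<lambda>i j. \<nu> * hessian f x i j) (outer (gradient f x)))"
    if x: "x \<in> Euclidean_space n interior_of K" for x
  proof (cases "\<nu> = 0")
    case True
    then show ?thesis
      using loewner[OF x, of 1 \<nu>] ineq[OF x] by simp
  next
    case False
    with \<open>0 \<le> \<nu>\<close> have "0 < \<nu>" by simp
    then show ?thesis
      using loewner[OF x, of "1 / \<nu>" 1] ineq[OF x] by (simp add: field_simps)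
  qed
  then show ?thesis
    using assms(2) by (simp add: self_concordant_barrier_def)
qed

section \<open>Powers of a body\<close>

text \<open>
  The body is \<open>K\<^sup>k\<close>, the point \<open>(x, \<dots>, x)\<close> and the direction \<open>(v, \<dots>, v)\<close>. Stating only the values of
  the two forms at this one point suffices for the induction, because the local splitting needed in
  the step comes from the consistency of \<open>\<phi>\<close> on \<open>K \<times> K\<^sup>k\<close>.
\<close>

lemma diagonal_power:
  fixes \<phi> :: "nat \<Rightarrow> (nat \<Rightarrow> real) set \<Rightarrow> (nat \<Rightarrow> real) \<Rightarrow> real"
  assumes consistent: "\<And>m n K K' x x'. m \<ge> 1 \<Longrightarrow> n \<ge> 1 \<Longrightarrow> convex_body m K \<Longrightarrow> convex_body n K' \<Longrightarrow>
        x \<in> Euclidean_space m interior_of K \<Longrightarrow> x' \<in> Euclidean_space n interior_of K' \<Longrightarrow>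
        \<phi> (m + n) (prod_body m K K') (pair_vec m x x') = \<phi> m K x + \<phi> n K' x'"
    and n: "n \<ge> 1" and K: "convex_body n K" and x: "x \<in> Euclidean_space n interior_of K"
    and "k \<ge> 1"
  shows "\<exists>B X V. convex_body (k * n) B \<and> X \<in> Euclidean_space (k * n) interior_of B \<and>
           dir_deriv (k * n) (\<phi> (k * n) B) X V = real k * dir_deriv n (\<phi> n K) x v \<and>
           hess_form (k * n) (\<phi> (k * n) B) X V = real k * hess_form n (\<phi> n K) x v"
  using \<open>k \<ge> 1\<close>
proof (induction k rule: dec_induct)
  case base
  show ?case
    using K x by (intro exI[of _ K] exI[of _ x] exI[of _ v]) simp
next
  case (step k)
  then obtain B X V where B: "convex_body (k * n) B"
    and X: "X \<in> Euclidean_space (k * n) interior_of B"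
    and dir: "dir_deriv (k * n) (\<phi> (k * n) B) X V = real k * dir_deriv n (\<phi> n K) x v"
    and hess: "hess_form (k * n) (\<phi> (k * n) B) X V = real k * hess_form n (\<phi> n K) x v"
    by blast
  have "k * n \<ge> 1"
    using n step.hyps by simp
  note split = separable_sum_forms[where F = "\<phi> (n + k * n) (prod_body n K B)" and f = "\<phi> n K"
      and g = "\<phi> (k * n) B" and v = v and v' = V,
      OF openin_interior_of openin_interior_of consistent[OF n this K B] x X]
  show ?case
    unfolding mult_Suc
    by (intro exI[of _ "prod_body n K B"] exI[of _ "pair_vec n x X"] exI[of _ "pair_vec n v V"]
        conjI convex_body_prod_body[OF K B] pair_vec_in_interior[OF K B x X])
       (simp_all add: split dir hess algebra_simps)
qed

theorem lemma1:
  fixes \<nu> :: "nat \<Rightarrow> real"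
    and \<phi> :: "nat \<Rightarrow> (nat \<Rightarrow> real) set \<Rightarrow> (nat \<Rightarrow> real) \<Rightarrow> real"
  assumes nu_pos: "\<And>n. n \<ge> 1 \<Longrightarrow> \<nu> n > 0"
    and barrier: "\<And>n K. n \<ge> 1 \<Longrightarrow> convex_body n K \<Longrightarrow> self_concordant_barrier (\<nu> n) n K (\<phi> n K)"
    and consistent: "\<And>m n K K' x x'. m \<ge> 1 \<Longrightarrow> n \<ge> 1 \<Longrightarrow> convex_body m K \<Longrightarrow> convex_body n K' \<Longrightarrow>
        x \<in> Euclidean_space m interior_of K \<Longrightarrow> x' \<in> Euclidean_space n interior_of K' \<Longrightarrow>
        \<phi> (m + n) (prod_body m K K') (pair_vec m x x') = \<phi> m K x + \<phi> n K' x'"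
  shows "\<forall>n K. n \<ge> 1 \<longrightarrow> convex_body n K \<longrightarrow>
      self_concordant_barrier (INF k\<in>{1..}. \<nu> (k * n) / real k) n K (\<phi> n K)"
proof (intro allI impI)
  fix n K assume n: "n \<ge> (1::nat)" and K: "convex_body n K"
  let ?f = "\<phi> n K"
  note bar = barrier[OF n K] and pos = nu_pos[OF n]
  let ?\<mu> = "INF k\<in>{1..}. \<nu> (k * n) / real k"
  have nu_kn: "\<nu> (k * n) > 0" if "k \<ge> 1" for k
    using that n by (intro nu_pos) simp
  show "self_concordant_barrier ?\<mu> n K ?f"
  proof (rule self_concordant_barrierI)
    show "0 \<le> ?\<mu>"
      using nu_kn by (intro cINF_greatest) (auto simp: less_imp_le)
    show "twice_differentiable_in n ?f (Euclidean_space n interior_of K)"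
      using bar by (simp add: self_concordant_barrier_def)
    show "hessian ?f x i j = hessian ?f x j i"
      if "x \<in> Euclidean_space n interior_of K" "i < n" "j < n" for x i j
      using self_concordant_barrierD(1)[OF bar pos that] .
  next
    fix x v assume x: "x \<in> Euclidean_space n interior_of K"
    let ?d = "dir_deriv n ?f x v" and ?h = "hess_form n ?f x v"
    have bound: "?d\<^sup>2 \<le> \<nu> (k * n) / real k * ?h" if k: "k \<ge> 1" for k
    proof -
      obtain B X V where B: "convex_body (k * n) B"
        and X: "X \<in> Euclidean_space (k * n) interior_of B"
        and dir: "dir_deriv (k * n) (\<phi> (k * n) B) X V = real k * ?d"
        and hess: "hess_form (k * n) (\<phi> (k * n) B) X V = real k * ?h"
        using diagonal_power[of \<phi>, OF consistent n K x k] by blast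
      have "k * n \<ge> 1"
        using n k by simp
      from self_concordant_barrierD(2)[OF barrier[OF this B] nu_kn[OF k] X, of V]
      have "(real k * ?d)\<^sup>2 \<le> \<nu> (k * n) * (real k * ?h)"
        by (simp only: dir hess)
      then have "real k * (real k * ?d\<^sup>2) \<le> real k * (\<nu> (k * n) * ?h)"
        by (simp add: power2_eq_square mult_ac)
      then show ?thesis
        using k by (simp add: field_simps)
    qed
    show "?d\<^sup>2 \<le> ?\<mu> * ?h"
    proof (cases "?h > 0")
      case True
      have "?d\<^sup>2 / ?h \<le> ?\<mu>"
        using bound True by (intro cINF_greatest) (auto simp: field_simps)
      then show ?thesis
        using True by (simp add: field_simps)
    next
      \<comment> \<open>The bound for \<open>k = 1\<close> gives \<open>?h \<ge> 0\<close>, so here both sides vanish.\<close>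
      case False
      have "0 \<le> \<nu> n * ?h"
        using order_trans[OF zero_le_power2 bound[of 1]] by simp
      then have "?h = 0"
        using False pos by (simp add: zero_le_mult_iff)
      then show ?thesis
        using bound[of 1] by simp
    qed
  qed
qed

end
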